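(* Let $\mathscr{C}$ be a finite fuzzy covering on $\mathbb{U}$ and $O$ an overlap function. Let $N_4^{\mathscr{C}}$, $N_4^{\mathscr{C}_2}$ and $N_4^{\mathscr{C}_\cap}$ be the fuzzy neighborhood operators defined by $O$ from the coverings $\mathscr{C}$, $\mathscr{C}_2$ and $\mathscr{C}_\cap$ respectively. Then (1) $N_4^{\mathscr{C}}=N_4^{\mathscr{C}_2}$; (2) $N_4^{\mathscr{C}}=N_4^{\mathscr{C}_\cap}$.
   Context: $\mathbb{U}$ is a non-empty set; fuzzy subsets of $\mathbb{U}$ are maps $\mathbb{U}\to[0,1]$; inclusion is pointwise $\le$ and intersection is the pointwise infimum. A fuzzy covering on $\mathbb{U}$ is a collection $\mathscr{C}$ of fuzzy subsets of $\mathbb{U}$, none identically $0$, such that for every $x\in\mathbb{U}$ there is $K\in\mathscr{C}$ with $K(x)=1$. For $x\in\mathbb{U}$: $\mathbb{C}(\mathscr{C},x)=\{K\in\mathscr{C}:K(x)>0\}$; $MD(\mathscr{C},x)=\{K\in\mathbb{C}(\mathscr{C},x):\forall S\in\mathbb{C}(\mathscr{C},x),\ (S(x)=K(x)\text{ and }S\supseteq K)\Rightarrow S=K\}$. Derived coverings: $\mathscr{C}_2=\bigcup\{MD(\mathscr{C},x):x\in\mathbb{U}\}$; $\mathscr{C}_\cap=\mathscr{C}\setminus\{K\in\mathscr{C}:\exists\text{ non-empty }\mathscr{C}'\subseteq\mathscr{C}\setminus\{K\}\text{ with }K=\bigcap\mathscr{C}'\}$. An overlap function is a map $O:[0,1]^2\to[0,1]$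 that is commutative, increasing (non-decreasing in each argument), continuous, and satisfies $O(x,y)=0\iff xy=0$ and $O(x,y)=1\iff xy=1$. For a collection $\mathscr{D}$ of fuzzy sets and $x,y\in\mathbb{U}$: $N_4^{\mathscr{D}}(x)(y)=\sup_{K\in\mathscr{D}}O(K(x),K(y))$. Equality of operators means equality of $N(x)(y)$ for all $x,y\in\mathbb{U}$. *)

theory Defs
  imports "HOL-Analysis.Analysis"
begin

text \<open>The universe is the (automatically non-empty) type \<open>'a\<close>. Fuzzy subsets of it are real-valued
  functions subject to \<open>fuzzy_subset\<close>, so that inclusion is the library's pointwise order on functions.\<close>

type_synonym 'a fuzzy = "'a \<Rightarrow> real"

definition fuzzy_subset :: "'a fuzzy \<Rightarrow> bool" where
  "fuzzy_subset K \<longleftrightarrow> (\<forall>x. 0 \<le> K x \<and> K x \<le> 1)"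

text \<open>Infima and suprema below are taken in the conditionally complete order of the reals. They agree
  with those of the unit interval for non-empty collections of fuzzy subsets, and only such
  collections occur when the definitions are applied to a finite fuzzy covering.\<close>

definition fuzzy_Inter :: "'a fuzzy set \<Rightarrow> 'a fuzzy" where
  "fuzzy_Inter D = (\<lambda>x. INF K\<in>D. K x)"

definition fuzzy_covering :: "'a fuzzy set \<Rightarrow> bool" where
  "fuzzy_covering C \<longleftrightarrow>
     (\<forall>K\<in>C. fuzzy_subset K \<and> K \<noteq> (\<lambda>x. 0)) \<and> (\<forall>x. \<exists>K\<in>C. K x = 1)"

definition nbhd_system :: "'a fuzzy set \<Rightarrow> 'a \<Rightarrow> 'a fuzzy set" where
  "nbhd_system C x = {K \<in> C. K x > 0}"

definition max_description :: "'a fuzzy set \<Rightarrow> 'a \<Rightarrow> 'a fuzzy set" where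
  "max_description C x =
     {K \<in> nbhd_system C x. \<forall>S\<in>nbhd_system C x. S x = K x \<and> K \<le> S \<longrightarrow> S = K}"

definition covering_2 :: "'a fuzzy set \<Rightarrow> 'a fuzzy set" where
  "covering_2 C = (\<Union>x. max_description C x)"

definition covering_Inter :: "'a fuzzy set \<Rightarrow> 'a fuzzy set" where
  "covering_Inter C = C - {K \<in> C. \<exists>C'. C' \<noteq> {} \<and> C' \<subseteq> C - {K} \<and> K = fuzzy_Inter C'}"

text \<open>An overlap function is a total function on the reals of which only the restriction to the
  unit square is constrained (and used).\<close>

definition overlap_function :: "(real \<Rightarrow> real \<Rightarrow> real) \<Rightarrow> bool" where
  "overlap_function Ov \<longleftrightarrow>
     (\<forall>x\<in>{0..1}. \<forall>y\<in>{0..1}. Ov x y \<in> {0..1}) \<and>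
     (\<forall>x\<in>{0..1}. \<forall>y\<in>{0..1}. Ov x y = Ov y x) \<and>
     (\<forall>x\<in>{0..1}. mono_on {0..1} (\<lambda>y. Ov x y)) \<and>
     (\<forall>y\<in>{0..1}. mono_on {0..1} (\<lambda>x. Ov x y)) \<and>
     continuous_on ({0..1} \<times> {0..1}) (\<lambda>(x, y). Ov x y) \<and>
     (\<forall>x\<in>{0..1}. \<forall>y\<in>{0..1}. Ov x y = 0 \<longleftrightarrow> x * y = 0) \<and>
     (\<forall>x\<in>{0..1}. \<forall>y\<in>{0..1}. Ov x y = 1 \<longleftrightarrow> x * y = 1)"

definition N4 :: "(real \<Rightarrow> real \<Rightarrow> real) \<Rightarrow> 'a fuzzy set \<Rightarrow> 'a \<Rightarrow> 'a fuzzy" where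
  "N4 Ov D x y = (SUP K\<in>D. Ov (K x) (K y))"

end

(* Every member of a finite covering lies below a maximal one. Maximal members survive in both
   derived coverings, and O is monotone, so restricting the supremum to any subfamily that
   contains the maximal members does not change it. *)
theory Submission
  imports Defs
begin

text \<open>Passing from \<open>K\<close> to a larger \<open>M\<close> does not decrease
  \<open>Ov (K x) (K y)\<close>, so each term of the supremum over \<open>C\<close> is dominated by
  a term of the one over \<open>D\<close>; the converse inequality is inclusion.\<close>

lemma N4_eq_of_cofinal:
  assumes fin: "finite C" and ne: "C \<noteq> {}" and sub: "D \<subseteq> C"
    and fuzzy: "\<forall>K\<in>C. fuzzy_subset K" and Ov: "overlap_function Ov"
    and dom: "\<forall>K\<in>C. \<exists>M\<in>D. K \<le> M"
  shows "N4 Ov C = N4 Ov D"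
proof (intro ext)
  fix x y
  have le: "Ov (K x) (K y) \<le> Ov (M x) (M y)" if "K \<in> C" "M \<in> C" "K \<le> M" for K M
  proof -
    have unit: "K x \<in> {0..1}" "K y \<in> {0..1}" "M x \<in> {0..1}" "M y \<in> {0..1}"
      using fuzzy that by (auto simp: fuzzy_subset_def)
    have KM: "K x \<le> M x" "K y \<le> M y"
      using that(3) by (auto simp: le_fun_def)
    have m1: "\<forall>a\<in>{0..1}. mono_on {0..1} (\<lambda>b. Ov a b)"
      and m2: "\<forall>b\<in>{0..1}. mono_on {0..1} (\<lambda>a. Ov a b)"
      using Ov unfolding overlap_function_def by blast+
    \<comment> \<open>Monotonicity is given in each argument separately, so the comparison passes
      through the mixed value \<open>Ov (K x) (M y)\<close>.\<close>
    have "Ov (K x) (K y) \<le> Ov (K x) (M y)"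
      using mono_onD[OF bspec[OF m1 unit(1)] unit(2) unit(4) KM(2)] .
    also have "\<dots> \<le> Ov (M x) (M y)"
      using mono_onD[OF bspec[OF m2 unit(4)] unit(1) unit(3) KM(1)] .
    finally show ?thesis .
  qed
  have neD: "D \<noteq> {}"
    using ne dom by blast
  \<comment> \<open>Suprema of reals can be compared only for bounded families; finiteness supplies
    the bounds.\<close>
  have bdd: "bdd_above ((\<lambda>K. Ov (K x) (K y)) ` C)" "bdd_above ((\<lambda>K. Ov (K x) (K y)) ` D)"
    using fin finite_subset[OF sub fin] by auto
  have "(SUP K\<in>C. Ov (K x) (K y)) \<le> (SUP K\<in>D. Ov (K x) (K y))"
    using ne bdd(2) by (rule cSUP_mono) (use dom sub le in blast)
  moreover have "(SUP K\<in>D. Ov (K x) (K y)) \<le> (SUP K\<in>C. Ov (K x) (K y))"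
    using neD bdd(1) by (rule cSUP_mono) (use sub in blast)
  ultimately show "N4 Ov C x y = N4 Ov D x y"
    by (simp add: N4_def)
qed

text \<open>As \<open>M\<close> is not identically 0, it is positive at some \<open>z\<close>.
  Maximality in all of \<open>C\<close> then gives the condition at \<open>z\<close>, which only
  concerns those \<open>S\<close> that also agree with \<open>M\<close> there.\<close>

lemma maximal_in_covering_2:
  assumes "fuzzy_covering C" "M \<in> C" "\<forall>S\<in>C. M \<le> S \<longrightarrow> M = S"
  shows "M \<in> covering_2 C"
proof -
  obtain z where "M z \<noteq> 0" and "0 \<le> M z"
    using assms(1,2) unfolding fuzzy_covering_def fuzzy_subset_def by (metis ext)
  then have "M \<in> max_description C z"
    using assms(2,3) by (auto simp: max_description_def nbhd_system_def)
  then show ?thesis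
    by (auto simp: covering_2_def)
qed

text \<open>An intersection lies below each of its members. If \<open>M\<close> were one, maximality
  would make it equal to some \<open>S\<close> in \<open>C'\<close>, but \<open>C'\<close> omits
  \<open>M\<close>.\<close>

lemma maximal_in_covering_Inter:
  assumes "finite C" "M \<in> C" "\<forall>S\<in>C. M \<le> S \<longrightarrow> M = S"
  shows "M \<in> covering_Inter C"
proof -
  have False if C': "C' \<noteq> {}" "C' \<subseteq> C - {M}" "M = fuzzy_Inter C'" for C'
  proof -
    obtain S where S: "S \<in> C'"
      using C'(1) by blast
    \<comment> \<open>Makes the values at each point bounded below, so that the real infimum is a
      lower bound.\<close>
    have "finite C'"
      using C'(2) assms(1) finite_subset by blast
    then have "fuzzy_Inter C' \<le> S"
      using S by (auto simp: fuzzy_Inter_def le_fun_def intro!: cINF_lower)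
    then show False
      using S C' assms(3) by blast
  qed
  then show ?thesis
    using assms(2) unfolding covering_Inter_def by blast
qed

theorem proposition4p4:
  fixes C :: "'a fuzzy set" and Ov :: "real \<Rightarrow> real \<Rightarrow> real"
  assumes "finite C" and "fuzzy_covering C" and "overlap_function Ov"
  shows "N4 Ov C = N4 Ov (covering_2 C) \<and>
    N4 Ov C = N4 Ov (covering_Inter C)"
proof -
  have C: "C \<noteq> {}" "\<forall>K\<in>C. fuzzy_subset K"
    using assms(2) by (auto simp: fuzzy_covering_def)
  \<comment> \<open>In a finite order one can climb from any \<open>K\<close> to a maximal element
    above it.\<close>
  have max: "\<exists>M\<in>C. K \<le> M \<and> (\<forall>S\<in>C. M \<le> S \<longrightarrow> M = S)" if "K \<in> C" for K
    using finite_has_maximal2[OF assms(1) that] by blast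
  have "covering_2 C \<subseteq> C" "covering_Inter C \<subseteq> C"
    by (auto simp: covering_2_def max_description_def nbhd_system_def covering_Inter_def)
  moreover have "\<forall>K\<in>C. \<exists>M\<in>covering_2 C. K \<le> M"
    using max maximal_in_covering_2[OF assms(2)] by blast
  moreover have "\<forall>K\<in>C. \<exists>M\<in>covering_Inter C. K \<le> M"
    using max maximal_in_covering_Inter[OF assms(1)] by blast
  ultimately show ?thesis
    using N4_eq_of_cofinal[OF assms(1) C(1) _ C(2) assms(3)] by blast
qed

end
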